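(* Let $\mathbf{k}$ be a field of characteristic $0$, let $\Delta$ be an additive subgroup of $\mathbf{k}$, let $J=\{0\}$ or $J=\mathbb{N}$, assume $\{0\}\neq\Delta+J\subset\mathbf{k}$, and let $b\in\mathbf{k}$. Let $(A,\circ)$ be the infinite-dimensional simple Novikov algebra over $\mathbf{k}$ with basis $\{x_{\alpha,j}\mid\alpha\in\Delta,\ j\in J\}$ and product $$x_{\alpha,i}\circ x_{\beta,j}=(\beta+b)x_{\alpha+\beta,i+j}+j\,x_{\alpha+\beta,i+j-1}\qquad(\alpha,\beta\in\Delta,\ i,j\in J).$$ Then there are no non-trivial transposed Novikov-Poisson algebra structures on $(A,\circ)$.
   Context: All binary operations are $\mathbf{k}$-bilinear and algebras need not be unital; $\mathbb{N}$ is the set of non-negative integers (viewed in $\mathbf{k}$ when forming $\Delta+J$). In the product formula the second term is read as $0$ when $j=0$. A (left) Novikov algebra $(A,\circ)$ is a vector space with a binary operation satisfying $(x\circ y)\circ z=(x\circ z)\circ y$ and $(x\circ y)\circ z-x\circ(y\circ z)=(y\circ x)\circ z-y\circ(x\circ z)$ for all $x,y,z$; it is simple if $A\circ A\neq\{0\}$ and its only (two-sided) ideals are $\{0\}$ and $A$. A transposed Novikov-Poisson algebra is a triple $(A,\cdot,\circ)$ where $(A,\cdot)$ is a commutative associative algebra, $(A,\circ)$ is a Novikov algebra, and for all $x,y,z\in A$: $(x\cdot y)\circ z=(x\cdot z)\circ y$ and $2z\cdot(x\circ y)=(z\cdot x)\circ y+x\circ(z\cdot y)$. It is trivial if $\cdot$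 is zero or $\circ$ is zero. A non-trivial transposed Novikov-Poisson algebra structure on $(A,\circ)$ is an operation $\cdot$ on $A$ such that $(A,\cdot,\circ)$ is a transposed Novikov-Poisson algebra that is not trivial. *)

theory Defs
  imports Complex_Main
begin

text \<open>
  Algebras are carried by whole types: the underlying vector space is a type \<open>'v\<close> with an
  explicit scalar multiplication. They need be neither associative nor unital.
\<close>

locale bilinear_algebra = vector_space scale
  for scale :: "'k::field \<Rightarrow> 'v::ab_group_add \<Rightarrow> 'v" +
  fixes mul :: "'v \<Rightarrow> 'v \<Rightarrow> 'v"
  assumes linear_right: "Vector_Spaces.linear scale scale (\<lambda>y. mul x y)"
    and linear_left: "Vector_Spaces.linear scale scale (\<lambda>x. mul x y)"

locale comm_assoc_algebra = bilinear_algebra scale dot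
  for scale :: "'k::field \<Rightarrow> 'v::ab_group_add \<Rightarrow> 'v"
    and dot :: "'v \<Rightarrow> 'v \<Rightarrow> 'v" +
  assumes comm: "dot x y = dot y x"
    and assoc: "dot (dot x y) z = dot x (dot y z)"

locale novikov_algebra = bilinear_algebra scale circ
  for scale :: "'k::field \<Rightarrow> 'v::ab_group_add \<Rightarrow> 'v"
    and circ :: "'v \<Rightarrow> 'v \<Rightarrow> 'v" +
  assumes right_comm: "circ (circ x y) z = circ (circ x z) y"
    and left_symmetric:
      "circ (circ x y) z - circ x (circ y z) = circ (circ y x) z - circ y (circ x z)"

locale transposed_novikov_poisson_algebra =
  dot: comm_assoc_algebra scale dot + circ: novikov_algebra scale circ
  for scale :: "'k::field \<Rightarrow> 'v::ab_group_add \<Rightarrow> 'v"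
    and dot circ :: "'v \<Rightarrow> 'v \<Rightarrow> 'v" +
  assumes dot_circ_comm: "circ (dot x y) z = circ (dot x z) y"
    and transposed_leibniz:
      "scale 2 (dot z (circ x y)) = circ (dot z x) y + circ x (dot z y)"

definition trivial_ops :: "('v::zero \<Rightarrow> 'v \<Rightarrow> 'v) \<Rightarrow> ('v \<Rightarrow> 'v \<Rightarrow> 'v) \<Rightarrow> bool"
  where "trivial_ops dot circ \<longleftrightarrow> (\<forall>x y. dot x y = 0) \<or> (\<forall>x y. circ x y = 0)"

definition nontrivial_tnp_structure ::
    "('k::field \<Rightarrow> 'v::ab_group_add \<Rightarrow> 'v) \<Rightarrow> ('v \<Rightarrow> 'v \<Rightarrow> 'v) \<Rightarrow> ('v \<Rightarrow> 'v \<Rightarrow> 'v) \<Rightarrow> bool"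
  where "nontrivial_tnp_structure scale circ dot \<longleftrightarrow>
    transposed_novikov_poisson_algebra scale dot circ \<and> \<not> trivial_ops dot circ"

definition additive_subgroup_of_field :: "'k::field set \<Rightarrow> bool"
  where "additive_subgroup_of_field \<Delta> \<longleftrightarrow>
    0 \<in> \<Delta> \<and> (\<forall>a\<in>\<Delta>. \<forall>b\<in>\<Delta>. a + b \<in> \<Delta>) \<and> (\<forall>a\<in>\<Delta>. - a \<in> \<Delta>)"

definition basis_family ::
    "('k::field \<Rightarrow> 'v::ab_group_add \<Rightarrow> 'v) \<Rightarrow> 'i set \<Rightarrow> ('i \<Rightarrow> 'v) \<Rightarrow> bool"
  where "basis_family scale I v \<longleftrightarrow>
    inj_on v I \<and> \<not> module.dependent scale (v ` I) \<and> module.span scale (v ` I) = UNIV"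

text \<open>
  Bilinearity, the basis and the multiplication table determine the algebra up to isomorphism.
  That it is an infinite-dimensional simple Novikov algebra (for characteristic 0 and
  \<open>\<Delta> + J \<noteq> {0}\<close>) is a consequence of this data, so it is not imposed as an axiom.
  The values of \<open>x\<close> outside \<open>\<Delta> \<times> J\<close> are irrelevant: in the term with coefficient
  \<open>j\<close>, the index \<open>i + j - 1\<close> is only used for \<open>j \<noteq> 0\<close>, when the subtraction
  is exact and \<open>J\<close> contains all naturals.
\<close>

locale delta_J_algebra = bilinear_algebra scale circ
  for \<Delta> :: "'k::field set" and J :: "nat set" and b :: 'k
    and scale :: "'k \<Rightarrow> 'v::ab_group_add \<Rightarrow> 'v"
    and x :: "'k \<Rightarrow> nat \<Rightarrow> 'v"
    and circ :: "'v \<Rightarrow> 'v \<Rightarrow> 'v" +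
  assumes basis: "basis_family scale (\<Delta> \<times> J) (\<lambda>(\<alpha>, j). x \<alpha> j)"
    and circ_basis: "\<lbrakk>\<alpha> \<in> \<Delta>; \<beta> \<in> \<Delta>; i \<in> J; j \<in> J\<rbrakk> \<Longrightarrow>
      circ (x \<alpha> i) (x \<beta> j) = scale (\<beta> + b) (x (\<alpha> + \<beta>) (i + j)) +
        (if j = 0 then 0 else scale (of_nat j) (x (\<alpha> + \<beta>) (i + j - 1)))"

end

theory Submission
  imports Defs
begin

text \<open>
  Write \<open>R\<^sub>y\<close> for the right multiplication \<open>f \<mapsto> f \<circ> y\<close>. All right multiplications of a Novikov
  algebra commute, and the law \<open>(x \<cdot> y) \<circ> z = (x \<cdot> z) \<circ> y\<close> moves an argument of the dot product
  into a right multiplication. So as soon as some product \<open>R\<^sub>e\<^sub>' R\<^sub>e\<close> is a non-zero scalar, this law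
  can be solved for the dot product, and with commutativity it leaves a single free element \<open>c\<close>:
  \<open>z \<cdot> x = (c \<circ> z) \<circ> x\<close> (lemma \<open>dot_eq_iterated_circ\<close>). Inserting this into the transposed
  Leibniz rule and using left symmetry, one finds that every \<open>p = c \<circ> z\<close> satisfies
  \<open>p \<circ> (x \<circ> y) = (x \<circ> p) \<circ> y\<close> for all \<open>x\<close>, \<open>y\<close> (lemma \<open>multiplier_identity\<close>).

  The algebra at hand is \<open>f \<circ> g = f * \<partial>g\<close> for the commutative product \<open>*\<close> that adds indices, where
  \<open>\<partial> = D + b\<close>, \<open>D\<close> is the derivation sending \<open>x\<^bsub>\<alpha>,j\<^esub>\<close> to \<open>\<alpha> x\<^bsub>\<alpha>,j\<^esub> + j x\<^bsub>\<alpha>,j-1\<^esub>\<close>, and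
  \<open>u = x\<^bsub>0,0\<^esub>\<close> is the unit of \<open>*\<close>. Thus \<open>u \<circ> y = \<partial>y\<close>, and the identity above with \<open>x = u\<close> reads
  \<open>p * \<partial>\<partial>y = \<partial>p * \<partial>y\<close>. It says that \<open>\<partial>p\<close> equals \<open>\<lambda>p\<close> for every eigenvalue \<open>\<lambda> \<noteq> 0\<close> of \<open>\<partial>\<close>
  with an invertible eigenvector \<open>y\<close>. If \<open>\<Delta>\<close> contains a non-zero element, it also contains some
  \<open>\<alpha> \<noteq> 0\<close> with \<open>\<alpha>\<^sup>2 \<noteq> b\<^sup>2\<close>, and then \<open>x\<^bsub>\<alpha>,0\<^esub>\<close> and \<open>x\<^bsub>-\<alpha>,0\<^esub>\<close> have different non-zero
  eigenvalues \<open>b + \<alpha>\<close> and \<open>b - \<alpha>\<close>, which forces \<open>p = 0\<close>. Otherwise \<open>J\<close> contains all naturals, and \<open>y = x\<^bsub>0,0\<^esub>\<close>, \<open>x\<^bsub>0,1\<^esub>\<close>, \<open>x\<^bsub>0,2\<^esub>\<close> (the powers of a variable) force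
  \<open>p = 0\<close>. In both cases the dot product \<open>z \<cdot> x = p \<circ> x\<close> vanishes.
\<close>

section \<open>Calculation rules in a bilinear algebra\<close>

context bilinear_algebra
begin

lemma mul_add_right: "mul f (g + h) = mul f g + mul f h"
  using linear_right[of f] by (simp add: linear_iff_module_hom module_hom_iff)

lemma mul_scale_right: "mul f (scale r g) = scale r (mul f g)"
  using linear_right[of f] by (simp add: linear_iff_module_hom module_hom_iff)

lemma mul_add_left: "mul (f + g) h = mul f h + mul g h"
  using linear_left[of h] by (simp add: linear_iff_module_hom module_hom_iff)

lemma mul_scale_left: "mul (scale r f) h = scale r (mul f h)"
  using linear_left[of h] by (simp add: linear_iff_module_hom module_hom_iff)

lemma mul_zero_left: "mul 0 h = 0"
  using mul_add_left[of 0 0 h] by simp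

end

section \<open>Transposed Novikov-Poisson structures with an invertible right multiplication\<close>

context transposed_novikov_poisson_algebra
begin

text \<open>
  Up to the factor \<open>k\<close>, \<open>z \<cdot> y\<close> is \<open>((z \<cdot> y) \<circ> e) \<circ> e' = ((z \<cdot> e) \<circ> y) \<circ> e' = ((z \<cdot> e) \<circ> e') \<circ> y\<close>, so
  only the products \<open>z \<cdot> e = e \<cdot> z\<close> matter. The same argument for \<open>e \<cdot> z\<close> leaves only \<open>e \<cdot> e\<close>.
\<close>
lemma dot_eq_iterated_circ:
  assumes "k \<noteq> 0" and inv: "\<And>f. circ (circ f e) e' = scale k f"
  obtains c where "\<And>z y. dot z y = circ (circ c z) y"
proof -
  define h where "h z = scale (inverse k) (circ (dot z e) e')" for z
  have dot_h: "dot z y = circ (h z) y" for z y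
  proof -
    have "scale k (dot z y) = circ (circ (dot z y) e) e'"
      by (simp add: inv)
    also have "\<dots> = circ (circ (dot z e) e') y"
      by (metis dot_circ_comm circ.right_comm)
    also have "\<dots> = scale k (circ (h z) y)"
      using \<open>k \<noteq> 0\<close> by (simp add: h_def circ.mul_scale_left)
    finally show ?thesis
      using \<open>k \<noteq> 0\<close> by simp
  qed
  define c where "c = scale (inverse k) (circ (h e) e')"
  have "h z = circ c z" for z
  proof -
    have "dot z e = circ (h e) z"
      by (metis dot.comm dot_h)
    then show ?thesis
      by (simp add: h_def[of z] c_def circ.mul_scale_left circ.right_comm[of "h e" z])
  qed
  with dot_h that show ?thesis
    by simp
qed

text \<open>
  With \<open>p = c \<circ> z\<close> the transposed Leibniz rule is
  \<open>2 p \<circ> (x \<circ> y) = (p \<circ> x) \<circ> y + x \<circ> (p \<circ> y)\<close>, and left symmetry for \<open>p\<close>, \<open>x\<close>, \<open>y\<close> replaces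
  the last term by \<open>p \<circ> (x \<circ> y) - (p \<circ> x) \<circ> y + (x \<circ> p) \<circ> y\<close>.
\<close>
lemma multiplier_identity:
  assumes "\<And>z y. dot z y = circ (circ c z) y"
  shows "circ (circ c z) (circ f g) = circ (circ f (circ c z)) g"
proof -
  let ?p = "circ c z"
  have two: "scale 2 v = v + v" for v
    using dot.scale_left_distrib[of 1 1 v] by simp
  have "circ ?p (circ f g) + circ ?p (circ f g) = circ (circ ?p f) g + circ f (circ ?p g)"
    using transposed_leibniz[of z f g] by (simp add: assms two)
  moreover have "circ (circ ?p f) g - circ ?p (circ f g) = circ (circ f ?p) g - circ f (circ ?p g)"
    by (rule circ.left_symmetric)
  ultimately show ?thesis
    by (simp add: algebra_simps)
qed

end

section \<open>Right multiplications by basis elements\<close>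

context delta_J_algebra
begin

lemma linear_eqI_basis:
  assumes "Vector_Spaces.linear scale scale F" "Vector_Spaces.linear scale scale G"
    and "\<And>\<alpha> i. \<alpha> \<in> \<Delta> \<Longrightarrow> i \<in> J \<Longrightarrow> F (x \<alpha> i) = G (x \<alpha> i)"
  shows "F f = G f"
proof -
  interpret vector_space_pair scale scale ..
  have "f \<in> span ((\<lambda>(\<alpha>, j). x \<alpha> j) ` (\<Delta> \<times> J))"
    using basis by (simp add: basis_family_def)
  then show ?thesis
    by (rule linear_eq_on_span[OF assms(1,2), rotated]) (clarsimp simp: assms(3))
qed

lemma linear_circ_left: "Vector_Spaces.linear scale scale (\<lambda>f. circ f y)"
  by (rule linear_left)

lemma linear_scale: "Vector_Spaces.linear scale scale (scale r)"
  by (simp add: linear_iff_module_hom module_hom_iff module_axioms scale_right_distrib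
      scale_left_commute)

lemma circ_unit:
  assumes "0 \<in> \<Delta>" "0 \<in> J"
  shows "circ f (x 0 0) = scale b f"
  by (rule linear_eqI_basis[OF linear_circ_left linear_scale])
     (use assms in \<open>simp add: circ_basis\<close>)

lemma circ_variable:
  assumes "b = 0" "0 \<in> \<Delta>" "1 \<in> J"
  shows "circ f (x 0 1) = f"
proof -
  have "circ f (x 0 1) = scale 1 f"
    by (rule linear_eqI_basis[OF linear_circ_left linear_scale])
       (use assms in \<open>simp add: circ_basis\<close>)
  then show ?thesis
    by simp
qed

lemma circ_opposite_exponents:
  assumes "additive_subgroup_of_field \<Delta>" "0 \<in> J" "\<alpha> \<in> \<Delta>"
  shows "circ (circ f (x \<alpha> 0)) (x (- \<alpha>) 0) = scale (b\<^sup>2 - \<alpha>\<^sup>2) f"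
proof (rule linear_eqI_basis[OF _ linear_scale])
  show "Vector_Spaces.linear scale scale (\<lambda>f. circ (circ f (x \<alpha> 0)) (x (- \<alpha>) 0))"
    by (simp add: linear_iff_module_hom module_hom_iff module_axioms
        mul_add_left mul_scale_left)
next
  fix \<beta> i
  assume "\<beta> \<in> \<Delta>" "i \<in> J"
  moreover from this have "\<beta> + \<alpha> \<in> \<Delta>" "- \<alpha> \<in> \<Delta>"
    using assms by (simp_all add: additive_subgroup_of_field_def)
  ultimately have "circ (circ (x \<beta> i) (x \<alpha> 0)) (x (- \<alpha>) 0)
      = scale ((\<alpha> + b) * (- \<alpha> + b)) (x \<beta> i)"
    using assms by (simp add: circ_basis mul_scale_left)
  also have "(\<alpha> + b) * (- \<alpha> + b) = b\<^sup>2 - \<alpha>\<^sup>2"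
    by (simp add: power2_eq_square algebra_simps)
  finally show "circ (circ (x \<beta> i) (x \<alpha> 0)) (x (- \<alpha>) 0) = scale (b\<^sup>2 - \<alpha>\<^sup>2) (x \<beta> i)" .
qed

section \<open>Vanishing of the multiplier\<close>

text \<open>
  Taking \<open>y = x\<^bsub>\<alpha>,0\<^esub>\<close> and then undoing the invertible right multiplication by \<open>y\<close> gives
  \<open>\<partial>p = (\<alpha> + b) p\<close>. The same with \<open>- \<alpha>\<close> gives \<open>\<partial>p = (- \<alpha> + b) p\<close>, so \<open>2 \<alpha> p = 0\<close>.
\<close>
lemma multiplier_eq_0_exponent:
  assumes \<Delta>: "additive_subgroup_of_field \<Delta>" and J: "0 \<in> J" and two: "(2::'k) \<noteq> 0"
    and \<alpha>: "\<alpha> \<in> \<Delta>" "\<alpha> \<noteq> 0" "\<alpha>\<^sup>2 \<noteq> b\<^sup>2"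
    and p: "\<And>y. circ p (circ (x 0 0) y) = circ (circ (x 0 0) p) y"
  shows "p = 0"
proof -
  have eigen: "circ (x 0 0) p = scale (\<gamma> + b) p" if \<gamma>: "\<gamma> \<in> \<Delta>" "\<gamma>\<^sup>2 \<noteq> b\<^sup>2" for \<gamma>
  proof -
    have "circ (x 0 0) (x \<gamma> 0) = scale (\<gamma> + b) (x \<gamma> 0)"
      using \<Delta> J \<gamma> by (simp add: additive_subgroup_of_field_def circ_basis)
    then have "circ (circ (x 0 0) p) (x \<gamma> 0) = circ (scale (\<gamma> + b) p) (x \<gamma> 0)"
      using p[of "x \<gamma> 0"] by (simp add: mul_scale_right mul_scale_left)
    then have "scale (b\<^sup>2 - \<gamma>\<^sup>2) (circ (x 0 0) p) = scale (b\<^sup>2 - \<gamma>\<^sup>2) (scale (\<gamma> + b) p)"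
      using circ_opposite_exponents[OF \<Delta> J \<gamma>(1)] by metis
    then show ?thesis
      using \<gamma> by (metis right_minus_eq scale_left_imp_eq)
  qed
  have "- \<alpha> \<in> \<Delta>"
    using \<Delta> \<alpha> by (simp add: additive_subgroup_of_field_def)
  then have "scale (\<alpha> + b) p = scale (- \<alpha> + b) p"
    using eigen[of \<alpha>] eigen[of "- \<alpha>"] \<alpha> by simp
  moreover have "\<alpha> + b \<noteq> - \<alpha> + b"
  proof
    assume "\<alpha> + b = - \<alpha> + b"
    then have "2 * \<alpha> = 0"
      by (metis add_right_imp_eq mult_2 right_minus)
    with two \<alpha> show False
      by simp
  qed
  ultimately show ?thesis
    by (metis scale_right_imp_eq)
qed

text \<open>
  Write \<open>t = x\<^bsub>0,1\<^esub>\<close>, so that \<open>\<partial>t = u + b t\<close>. If \<open>b \<noteq> 0\<close>, then \<open>y = u\<close> gives \<open>\<partial>p = b p\<close>, and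
  the identity for \<open>y = t\<close> becomes \<open>b p + b (p \<circ> t) = b (p \<circ> t)\<close>. If \<open>b = 0\<close>, right
  multiplication by \<open>t\<close> is the identity; then \<open>y = t\<close> gives \<open>\<partial>p = 0\<close>, and
  \<open>y = x\<^bsub>0,2\<^esub>\<close> with \<open>\<partial>y = 2 t\<close> gives \<open>2 p = 0\<close>.
\<close>
lemma multiplier_eq_0_polynomial:
  assumes \<Delta>: "0 \<in> \<Delta>" and J: "J = UNIV" and two: "(2::'k) \<noteq> 0"
    and p: "\<And>y. circ p (circ (x 0 0) y) = circ (circ (x 0 0) p) y"
  shows "p = 0"
proof (cases "b = 0")
  case False
  have "scale b (scale b p) = scale b (circ (x 0 0) p)"
    using p[of "x 0 0"] \<Delta> J by (simp add: circ_unit mul_scale_right)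
  then have "circ (x 0 0) p = scale b p"
    using False by (metis scale_left_imp_eq)
  moreover have "circ (x 0 0) (x 0 1) = scale b (x 0 1) + x 0 0"
    using \<Delta> J by (simp add: circ_basis)
  ultimately have "scale b p = 0"
    using p[of "x 0 1"] \<Delta> J
    by (simp add: mul_add_right mul_scale_right mul_scale_left circ_unit)
  with False show ?thesis
    by simp
next
  case True
  have "circ (x 0 0) (x 0 1) = x 0 0"
    using \<Delta> J True by (simp add: circ_basis)
  then have "circ (x 0 0) p = 0"
    using p[of "x 0 1"] \<Delta> J circ_variable[of "circ (x 0 0) p"]
    by (simp add: circ_unit True)
  moreover have "circ (x 0 0) (x 0 2) = scale 2 (x 0 1)"
    using \<Delta> J True by (simp add: circ_basis)
  ultimately have "scale 2 p = 0"
    using p[of "x 0 2"] \<Delta> J True circ_variable[of p]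
    by (simp add: mul_scale_right mul_zero_left)
  with two show ?thesis
    by simp
qed

text \<open>
  The pairs \<open>e\<close>, \<open>e'\<close> of right multiplications with scalar product are \<open>x\<^bsub>\<alpha>,0\<^esub>\<close>, \<open>x\<^bsub>-\<alpha>,0\<^esub>\<close> if a
  suitable \<open>\<alpha>\<close> exists; otherwise the unit twice, or for \<open>b = 0\<close> the variable \<open>x\<^bsub>0,1\<^esub>\<close> twice.
\<close>
lemma transposed_dot_eq_0:
  assumes tnp: "transposed_novikov_poisson_algebra scale dot circ"
    and \<Delta>: "additive_subgroup_of_field \<Delta>" and two: "(2::'k) \<noteq> 0"
    and cases: "(\<exists>\<alpha>\<in>\<Delta>. \<alpha> \<noteq> 0 \<and> \<alpha>\<^sup>2 \<noteq> b\<^sup>2) \<and> 0 \<in> J \<or> J = UNIV"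
  shows "dot f g = 0"
proof -
  interpret tnp: transposed_novikov_poisson_algebra scale dot circ
    by (rule tnp)
  have zero: "0 \<in> \<Delta>"
    using \<Delta> by (simp add: additive_subgroup_of_field_def)
  have "\<exists>k e e'. k \<noteq> 0 \<and> (\<forall>f. circ (circ f e) e' = scale k f)"
    using cases
  proof
    assume "(\<exists>\<alpha>\<in>\<Delta>. \<alpha> \<noteq> 0 \<and> \<alpha>\<^sup>2 \<noteq> b\<^sup>2) \<and> 0 \<in> J"
    then show ?thesis
      using circ_opposite_exponents[OF \<Delta>] by (metis right_minus_eq)
  next
    assume J: "J = UNIV"
    show ?thesis
    proof (cases "b = 0")
      case False
      then have "b * b \<noteq> 0" "\<forall>f. circ (circ f (x 0 0)) (x 0 0) = scale (b * b) f"
        using zero J by (simp_all add: circ_unit)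
      then show ?thesis
        by blast
    next
      case True
      then have "\<forall>f. circ (circ f (x 0 1)) (x 0 1) = scale 1 f"
        using zero J circ_variable by simp
      then show ?thesis
        by (metis zero_neq_one)
    qed
  qed
  then obtain c where c: "\<And>z y. dot z y = circ (circ c z) y"
    using tnp.dot_eq_iterated_circ by metis
  have "circ c f = 0"
    using cases multiplier_eq_0_exponent[OF \<Delta> _ two, of _ "circ c f"]
      multiplier_eq_0_polynomial[OF zero _ two, of "circ c f"]
      tnp.multiplier_identity[OF c, where f = "x 0 0"]
    by blast
  then show ?thesis
    by (simp add: c mul_zero_left)
qed

end

section \<open>Absence of non-trivial structures\<close>

theorem corollary4p14:
  fixes \<Delta> :: "'k::field_char_0 set"
    and J :: "nat set"
    and b :: 'k
    and scale :: "'k \<Rightarrow> 'v::ab_group_add \<Rightarrow> 'v"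
    and x :: "'k \<Rightarrow> nat \<Rightarrow> 'v"
    and circ :: "'v \<Rightarrow> 'v \<Rightarrow> 'v"
  assumes "additive_subgroup_of_field \<Delta>"
    and "J = {0} \<or> J = UNIV"
    and "{\<alpha> + of_nat j | \<alpha> j. \<alpha> \<in> \<Delta> \<and> j \<in> J} \<noteq> {0}"
    and "delta_J_algebra \<Delta> J b scale x circ"
  shows "\<nexists>dot. nontrivial_tnp_structure scale circ dot"
proof -
  interpret delta_J_algebra \<Delta> J b scale x circ
    by (rule assms(4))
  have "(\<exists>\<alpha>\<in>\<Delta>. \<alpha> \<noteq> 0 \<and> \<alpha>\<^sup>2 \<noteq> b\<^sup>2) \<and> 0 \<in> J \<or> J = UNIV"
  proof (cases "J = UNIV")
    case False
    then have J: "J = {0}"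
      using assms(2) by simp
    have "0 \<in> \<Delta>"
      using assms(1) by (simp add: additive_subgroup_of_field_def)
    have "\<Delta> \<noteq> {0}"
      using assms(3) J by auto
    with \<open>0 \<in> \<Delta>\<close> obtain \<alpha> where \<alpha>: "\<alpha> \<in> \<Delta>" "\<alpha> \<noteq> 0"
      by blast
    \<comment> \<open>The squares of \<open>\<alpha>\<close> and \<open>2 \<alpha>\<close> differ, so one of them is not \<open>b\<^sup>2\<close>.\<close>
    have "2 * \<alpha> \<in> \<Delta>"
      using assms(1) \<alpha> unfolding additive_subgroup_of_field_def mult_2 by blast
    moreover have "2 * \<alpha> \<noteq> 0" "(2 * \<alpha>)\<^sup>2 \<noteq> \<alpha>\<^sup>2"
      using \<alpha> by (simp_all add: power_mult_distrib)
    ultimately show ?thesis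
      using \<alpha> J by (metis singletonI)
  qed simp
  then have "dot f g = 0" if "transposed_novikov_poisson_algebra scale dot circ" for dot f g
    using transposed_dot_eq_0[OF that assms(1)] by simp
  then show ?thesis
    by (auto simp: nontrivial_tnp_structure_def trivial_ops_def)
qed

end
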